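(* Any nontrivial normal subgroup of $\mathcal{L}_n$ is infinite. Therefore $\mathcal{L}_n$ is hereditary free from finite normal subgroups.
   Context: $p$ is a fixed prime, $n\ge 1$. $\mathcal{L}_n=(\mathbb{Z}/p\mathbb{Z})^n\wr\mathbb{Z}=\left(\bigoplus_{\mathbb{Z}}(\mathbb{Z}/p\mathbb{Z})^n\right)\rtimes\mathbb{Z}$, where the generator of $\mathbb{Z}$ acts by the shift by one. A group $G$ is called hereditary free from finite normal subgroups if for every subgroup $H\le G$ of finite index, every nontrivial normal subgroup of $H$ is infinite. *)

theory Defs
  imports
    "HOL-Computational_Algebra.Primes"
    "HOL-Algebra.Product_Groups"
    "HOL-Algebra.Bij"
begin

(* External semidirect product of N and H, where H acts on N through phi;
   this is a group when phi is a homomorphism from H to AutoGroup N. *)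
definition semidirect_product ::
    "('a, 'c) monoid_scheme \<Rightarrow> ('b, 'd) monoid_scheme \<Rightarrow> ('b \<Rightarrow> 'a \<Rightarrow> 'a) \<Rightarrow> ('a \<times> 'b) monoid"
  where "semidirect_product N H \<phi> =
    \<lparr>carrier = carrier N \<times> carrier H,
     monoid.mult = (\<lambda>(x, s) (y, t). (x \<otimes>\<^bsub>N\<^esub> \<phi> s y, s \<otimes>\<^bsub>H\<^esub> t)),
     one = (\<one>\<^bsub>N\<^esub>, \<one>\<^bsub>H\<^esub>)\<rparr>"

abbreviation int_direct_sum :: "('a, 'c) monoid_scheme \<Rightarrow> (int \<Rightarrow> 'a) monoid"
  where "int_direct_sum A \<equiv> sum_group (UNIV :: int set) (\<lambda>_. A)"

(* Restricted to the carrier because the elements of AutoGroup are extensional functions. *)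
definition shift_action :: "('a, 'c) monoid_scheme \<Rightarrow> int \<Rightarrow> (int \<Rightarrow> 'a) \<Rightarrow> (int \<Rightarrow> 'a)"
  where "shift_action A t = (\<lambda>x \<in> carrier (int_direct_sum A). (\<lambda>i. x (i - t)))"

definition wreath_integers :: "('a, 'c) monoid_scheme \<Rightarrow> ((int \<Rightarrow> 'a) \<times> int) monoid"
  where "wreath_integers A =
    semidirect_product (int_direct_sum A) integer_group (shift_action A)"

definition lamplighter_group :: "nat \<Rightarrow> nat \<Rightarrow> ((int \<Rightarrow> nat \<Rightarrow> int) \<times> int) monoid"
  where "lamplighter_group p n =
    wreath_integers (product_group {..<n} (\<lambda>_. integer_mod_group p))"

definition hereditary_free_from_finite_normal_subgroups :: "('a, 'c) monoid_scheme \<Rightarrow> bool"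
  where "hereditary_free_from_finite_normal_subgroups G \<longleftrightarrow>
    (\<forall>H. subgroup H G \<and> finite (rcosets\<^bsub>G\<^esub> H) \<longrightarrow>
      (\<forall>N. N \<lhd> G\<lparr>carrier := H\<rparr> \<and> N \<noteq> {\<one>\<^bsub>G\<^esub>} \<longrightarrow> infinite N))"

lemma group_semidirect_product:
  assumes N: "group N" and H: "group H" and \<phi>: "\<phi> \<in> hom H (AutoGroup N)"
  shows "group (semidirect_product N H \<phi>)"
proof -
  interpret N: group N by (rule N)
  interpret H: group H by (rule H)
  have au: "\<phi> s \<in> auto N" if "s \<in> carrier H" for s
    using \<phi> that by (auto simp: hom_def AutoGroup_def)
  have cl: "\<phi> s x \<in> carrier N" if "s \<in> carrier H" "x \<in> carrier N" for s x
    using au[OF that(1)] that(2) by (auto simp: auto_def hom_def)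
  have mu: "\<phi> s (x \<otimes>\<^bsub>N\<^esub> y) = \<phi> s x \<otimes>\<^bsub>N\<^esub> \<phi> s y"
    if "s \<in> carrier H" "x \<in> carrier N" "y \<in> carrier N" for s x y
    using au[OF that(1)] that(2,3) by (auto simp: auto_def hom_def)
  have co: "\<phi> (s \<otimes>\<^bsub>H\<^esub> t) x = \<phi> s (\<phi> t x)"
    if "s \<in> carrier H" "t \<in> carrier H" "x \<in> carrier N" for s t x
  proof -
    have "\<phi> (s \<otimes>\<^bsub>H\<^esub> t) = \<phi> s \<otimes>\<^bsub>AutoGroup N\<^esub> \<phi> t"
      using \<phi> that by (auto simp: hom_def)
    then show ?thesis
      using au[OF that(1)] au[OF that(2)] that(3)
      by (auto simp: AutoGroup_def BijGroup_def auto_def compose_def)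
  qed
  have on: "\<phi> \<one>\<^bsub>H\<^esub> x = x" if "x \<in> carrier N" for x
  proof -
    have "\<phi> \<one>\<^bsub>H\<^esub> = \<one>\<^bsub>AutoGroup N\<^esub>"
      using hom_one[OF \<phi> H N.AutoGroup] .
    then show ?thesis using that by (simp add: AutoGroup_def BijGroup_def)
  qed
  show ?thesis
  proof (rule groupI, goal_cases)
    case (5 z)
    then obtain x s where z: "z = (x, s)" "x \<in> carrier N" "s \<in> carrier H"
      by (auto simp: semidirect_product_def)
    let ?w = "(\<phi> (inv\<^bsub>H\<^esub> s) (inv\<^bsub>N\<^esub> x), inv\<^bsub>H\<^esub> s)"
    have "?w \<otimes>\<^bsub>semidirect_product N H \<phi>\<^esub> z =
        (\<phi> (inv\<^bsub>H\<^esub> s) (inv\<^bsub>N\<^esub> x \<otimes>\<^bsub>N\<^esub> x), \<one>\<^bsub>H\<^esub>)"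
      using z mu[of "inv\<^bsub>H\<^esub> s" "inv\<^bsub>N\<^esub> x" x, symmetric]
      by (simp add: semidirect_product_def del: N.l_inv)
    also have "\<dots> = \<one>\<^bsub>semidirect_product N H \<phi>\<^esub>"
    proof -
      have "\<phi> (inv\<^bsub>H\<^esub> s) \<in> hom N N" using au[of "inv\<^bsub>H\<^esub> s"] z by (auto simp: auto_def)
      then have "\<phi> (inv\<^bsub>H\<^esub> s) \<one>\<^bsub>N\<^esub> = \<one>\<^bsub>N\<^esub>" by (rule hom_one[OF _ N N])
      then show ?thesis using z by (simp add: semidirect_product_def)
    qed
    finally show ?case using z cl by (force simp: semidirect_product_def)
  qed (auto simp: semidirect_product_def cl mu co on N.m_assoc H.m_assoc)
qed

lemma shift_action_hom:
  assumes A: "group A"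
  shows "shift_action A \<in> hom integer_group (AutoGroup (int_direct_sum A))"
proof -
  interpret A: group A by (rule A)
  let ?S = "int_direct_sum A"
  have car: "carrier ?S = {x. (\<forall>i. x i \<in> carrier A) \<and> finite {i. x i \<noteq> \<one>\<^bsub>A\<^esub>}}"
    using A by (subst carrier_sum_group) (auto simp: PiE_def)
  have cl: "(\<lambda>i. x (i - t)) \<in> carrier ?S" if "x \<in> carrier ?S" for x t
  proof -
    have "{i. x (i - t) \<noteq> \<one>\<^bsub>A\<^esub>} = (\<lambda>i. i + t) ` {i. x i \<noteq> \<one>\<^bsub>A\<^esub>}"
      by (auto simp: image_iff) (metis diff_add_cancel)
    then show ?thesis using that by (auto simp: car)
  qed
  have inv: "\<exists>y \<in> carrier ?S. x = (\<lambda>i. y (i - t))" if "x \<in> carrier ?S" for x t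
    using cl[OF that, of "- t"] by (intro bexI[of _ "\<lambda>i. x (i - (- t))"]) auto
  have inj: "x = y" if "(\<lambda>i. x (i - t)) = (\<lambda>i. y (i - t))" for x y :: "int \<Rightarrow> 'a" and t
    using that by (metis add_diff_cancel_right' ext)
  have bij: "shift_action A t \<in> Bij (carrier ?S)" for t
    unfolding Bij_def bij_betw_def inj_on_def shift_action_def
    using cl[of _ t] inv[of _ t] inj[of _ t] by (auto simp: image_def)
  have hom: "shift_action A t \<in> hom ?S ?S" for t
  proof -
    have "x \<otimes>\<^bsub>?S\<^esub> y \<in> carrier ?S" if "x \<in> carrier ?S" "y \<in> carrier ?S" for x y
      using that by (rule monoid.m_closed[OF group.is_monoid[OF sum_group[OF A]]])
    then show ?thesis
      by (auto simp: hom_def shift_action_def cl)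
  qed
  have au: "shift_action A t \<in> auto ?S" for t
    using hom bij by (simp add: auto_def)
  have "shift_action A (s + t) = compose (carrier ?S) (shift_action A s) (shift_action A t)" for s t
    using cl by (auto simp: shift_action_def compose_def fun_eq_iff diff_diff_eq algebra_simps)
  then show ?thesis
    using au bij by (auto simp: hom_def AutoGroup_def BijGroup_def)
qed

lemma group_lamplighter_group: "group (lamplighter_group p n)"
  unfolding lamplighter_group_def wreath_integers_def
  by (intro group_semidirect_product shift_action_hom group_integer_group
      sum_group product_group group_integer_mod_group)

end

(* In a wreath product of A with the integers, let H be a subgroup of finite index and N a finite
   normal subgroup of H.  Projecting N to the integers gives a finite set closed under addition,
   so N lies in the base group.  By the pigeonhole principle H contains infinitely many pure
   translations; conjugating a nontrivial element of N by these yields elements of N whose supports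
   are not contained in any finite set, which contradicts the finiteness of N. *)
theory Submission
  imports Defs
begin

text \<open>Doubling the maximum or the minimum stays inside \<open>S\<close>, which forces
  \<open>Max S\<close> \<le> 0 \<le> \<open>Min S\<close>.\<close>

lemma finite_add_closed_int_set_eq_0:
  fixes S :: "int set"
  assumes "finite S" and add: "\<And>a b. a \<in> S \<Longrightarrow> b \<in> S \<Longrightarrow> a + b \<in> S" and "s \<in> S"
  shows "s = 0"
proof -
  have ne: "S \<noteq> {}" using \<open>s \<in> S\<close> by auto
  have "Max S + Max S \<le> Max S" "Min S \<le> Min S + Min S"
    using assms(1) ne by (meson Max_ge Max_in Min_in Min_le add)+
  moreover have "s \<le> Max S" "Min S \<le> s" using assms by auto
  ultimately show ?thesis by linarith
qed

lemma carrier_int_direct_sum: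
  assumes "group A"
  shows "carrier (int_direct_sum A) =
    {x. (\<forall>i. x i \<in> carrier A) \<and> finite {i. x i \<noteq> \<one>\<^bsub>A\<^esub>}}"
  using assms by (subst carrier_sum_group) (auto simp: PiE_def)

lemma group_wreath_integers:
  assumes "group A"
  shows "group (wreath_integers A)"
  unfolding wreath_integers_def
  using assms by (intro group_semidirect_product shift_action_hom group_integer_group sum_group)

lemma carrier_wreath_integers:
  "carrier (wreath_integers A) = carrier (int_direct_sum A) \<times> UNIV"
  by (simp add: wreath_integers_def semidirect_product_def)

lemma one_wreath_integers: "\<one>\<^bsub>wreath_integers A\<^esub> = (\<lambda>i. \<one>\<^bsub>A\<^esub>, 0)"
  by (simp add: wreath_integers_def semidirect_product_def fun_eq_iff)

lemma mult_wreath_integers: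
  assumes "y \<in> carrier (int_direct_sum A)"
  shows "(x, s) \<otimes>\<^bsub>wreath_integers A\<^esub> (y, t) = (\<lambda>i. x i \<otimes>\<^bsub>A\<^esub> y (i - s), s + t)"
  using assms
  by (simp add: wreath_integers_def semidirect_product_def shift_action_def fun_eq_iff)

text \<open>Infinitely many translations fall into one right coset of \<open>H\<close>, and the
  quotient of any two of them is again a translation, now inside \<open>H\<close>.\<close>

lemma finite_index_infinite_translations:
  assumes A: "group A" and H: "subgroup H (wreath_integers A)"
    and fin: "finite (rcosets\<^bsub>wreath_integers A\<^esub> H)"
  shows "infinite {t. (\<lambda>i. \<one>\<^bsub>A\<^esub>, t) \<in> H}"
proof -
  let ?G = "wreath_integers A"
  let ?e = "\<lambda>i :: int. \<one>\<^bsub>A\<^esub>"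
  interpret A: group A by (rule A)
  interpret G: group ?G by (rule group_wreath_integers[OF A])
  have e: "?e \<in> carrier (int_direct_sum A)"
    by (simp add: carrier_int_direct_sum[OF A])
  have eG: "(?e, t) \<in> carrier ?G" for t
    using e by (simp add: carrier_wreath_integers)
  let ?c = "\<lambda>t. H #>\<^bsub>?G\<^esub> (?e, t)"
  have "range ?c \<subseteq> rcosets\<^bsub>?G\<^esub> H"
    using eG by (auto simp: RCOSETS_def)
  then have "finite (range ?c)" using fin finite_subset by blast
  \<comment> \<open>\<open>k\<close> is a reference translation whose coset is hit infinitely
    often.\<close>
  then obtain k where k: "infinite {t \<in> UNIV. ?c t = ?c k}"
    using pigeonhole_infinite[OF infinite_UNIV_int] by blast
  have "(?e, t - k) \<in> H" if "?c t = ?c k" for t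
  proof -
    have "(?e, t) \<in> ?c k"
      using that G.rcos_self[OF eG H] by blast
    then obtain x s where h: "(x, s) \<in> H" "(?e, t) = (x, s) \<otimes>\<^bsub>?G\<^esub> (?e, k)"
      by (auto simp: r_coset_def)
    have "x i \<in> carrier A" for i
      using subgroup.mem_carrier[OF H h(1)]
      by (simp add: carrier_wreath_integers carrier_int_direct_sum[OF A])
    \<comment> \<open>Right multiplication by \<open>(?e, k)\<close> leaves the base component
      \<open>x\<close> unchanged and only adds \<open>k\<close> to \<open>s\<close>.\<close>
    then have "x = ?e" "s = t - k"
      using h(2) by (simp_all add: mult_wreath_integers[OF e] fun_eq_iff)
    then show ?thesis using h(1) by simp
  qed
  \<comment> \<open>Finitely many translations in \<open>H\<close>, moved by \<open>k\<close>, could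
    not cover this infinite fibre.\<close>
  then have "{t \<in> UNIV. ?c t = ?c k} \<subseteq> (\<lambda>s. s + k) ` {t. (?e, t) \<in> H}"
    by (auto intro: image_eqI[of _ _ "t - k" for t])
  then show ?thesis
    using k finite_surj by blast
qed

theorem wreath_integers_hereditary_free:
  assumes A: "group A"
  shows "hereditary_free_from_finite_normal_subgroups (wreath_integers A)"
  unfolding hereditary_free_from_finite_normal_subgroups_def
proof (intro allI impI notI; elim conjE)
  let ?G = "wreath_integers A"
  let ?e = "\<lambda>i :: int. \<one>\<^bsub>A\<^esub>"
  fix H N
  assume H: "subgroup H ?G" and idx: "finite (rcosets\<^bsub>?G\<^esub> H)"
    and N: "N \<lhd> ?G\<lparr>carrier := H\<rparr>" and nontriv: "N \<noteq> {\<one>\<^bsub>?G\<^esub>}" and fin: "finite N"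
  interpret A: group A by (rule A)
  interpret N: normal N "?G\<lparr>carrier := H\<rparr>" by (rule N)
  have NH: "N \<subseteq> H" using N.subset by simp
  have HG: "H \<subseteq> carrier ?G" using H by (rule subgroup.subset)
  have base: "x \<in> carrier (int_direct_sum A)" if "(x, s) \<in> N" for x s
    using that NH HG by (auto simp: carrier_wreath_integers)
  have mult: "u \<otimes>\<^bsub>?G\<^esub> v \<in> N" if "u \<in> N" "v \<in> N" for u v
    using subgroup.m_closed[OF normal_imp_subgroup[OF N] that] by simp
  have snd0: "s = 0" if xs: "(x, s) \<in> N" for x s
  proof (rule finite_add_closed_int_set_eq_0[of "snd ` N"])
    show "a + b \<in> snd ` N" if ab: "a \<in> snd ` N" "b \<in> snd ` N" for a b
    proof -
      obtain y z where "(y, a) \<in> N" "(z, b) \<in> N" using ab by auto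
      then show ?thesis
        using mult[of "(y, a)" "(z, b)"] base by (force simp: mult_wreath_integers)
    qed
  qed (use fin xs in force)+
  have "\<one>\<^bsub>?G\<^esub> \<in> N" using subgroup.one_closed[OF normal_imp_subgroup[OF N]] by simp
  then obtain x s where xN': "(x, s) \<in> N" "(x, s) \<noteq> \<one>\<^bsub>?G\<^esub>" using nontriv by auto
  then have xN: "(x, 0) \<in> N" and "x \<noteq> ?e" using snd0 by (auto simp: one_wreath_integers)
  then obtain j where j: "x j \<noteq> \<one>\<^bsub>A\<^esub>" by auto
  have e: "?e \<in> carrier (int_direct_sum A)"
    by (simp add: carrier_int_direct_sum[OF A])
  have conj: "(\<lambda>i. x (i - t), 0) \<in> N" if t: "(?e, t) \<in> H" for t
  proof -
    \<comment> \<open>Normality enters as equality of left and right cosets, so the conjugate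
      appears as the \<open>(y, r)\<close> with \<open>(?e, t)\<close> times \<open>(x, 0)\<close>
      equal to \<open>(y, r)\<close> times \<open>(?e, t)\<close>, and no inverse has to be
      computed.\<close>
    have "(?e, t) <#\<^bsub>?G\<^esub> N = N #>\<^bsub>?G\<^esub> (?e, t)"
      using N.coset_eq t by (simp add: r_coset_def l_coset_def)
    then have "(?e, t) \<otimes>\<^bsub>?G\<^esub> (x, 0) \<in> N #>\<^bsub>?G\<^esub> (?e, t)"
      using xN by (auto simp: l_coset_def)
    then obtain y r where y: "(y, r) \<in> N"
      and eq: "(?e, t) \<otimes>\<^bsub>?G\<^esub> (x, 0) = (y, r) \<otimes>\<^bsub>?G\<^esub> (?e, t)"
      by (auto simp: r_coset_def)
    have "x i \<in> carrier A" "y i \<in> carrier A" for i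
      using base[OF xN] base[OF y] by (simp_all add: carrier_int_direct_sum[OF A])
    then have "y = (\<lambda>i. x (i - t))"
      using eq by (simp add: mult_wreath_integers e base[OF xN] fun_eq_iff)
    then show ?thesis using y snd0[OF y] by simp
  qed
  \<comment> \<open>A finite union of finite supports: every element of \<open>N\<close> is trivial
    outside this set.\<close>
  let ?supp = "\<Union>y \<in> fst ` N. {i. y i \<noteq> \<one>\<^bsub>A\<^esub>}"
  have "finite ?supp"
    using fin base by (auto simp: carrier_int_direct_sum[OF A])
  \<comment> \<open>The conjugate by \<open>(?e, t)\<close> takes at \<open>j + t\<close> the
    nontrivial value \<open>x j\<close>.\<close>
  moreover have "(\<lambda>t. j + t) ` {t. (?e, t) \<in> H} \<subseteq> ?supp"
    using conj j by (force intro!: bexI[rotated])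
  ultimately have "finite {t. (?e, t) \<in> H}"
    by (meson finite_imageD finite_subset inj_onI add_left_imp_eq)
  then show False
    using finite_index_infinite_translations[OF A H idx] by simp
qed

text \<open>The whole group is a subgroup of finite index in itself, its only coset being the
  carrier.\<close>

lemma hereditary_free_imp_infinite_normal:
  assumes "group G" "hereditary_free_from_finite_normal_subgroups G"
    and "N \<lhd> G" "N \<noteq> {\<one>\<^bsub>G\<^esub>}"
  shows "infinite N"
proof -
  interpret group G by (rule assms(1))
  have "rcosets\<^bsub>G\<^esub> (carrier G) \<subseteq> {carrier G}"
    using coset_join2[OF _ subgroup_self] by (auto simp: RCOSETS_def)
  then have "finite (rcosets\<^bsub>G\<^esub> (carrier G))" by (rule finite_subset) simp
  moreover have "N \<lhd> G\<lparr>carrier := carrier G\<rparr>" using assms(3) by simp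
  ultimately show ?thesis
    using assms(2,4) subgroup_self
    unfolding hereditary_free_from_finite_normal_subgroups_def by blast
qed

theorem corollary3p15:
  fixes p n :: nat
  assumes "prime p" and "n \<ge> 1"
  shows "(\<forall>N. N \<lhd> lamplighter_group p n \<and> N \<noteq> {\<one>\<^bsub>lamplighter_group p n\<^esub>} \<longrightarrow> infinite N) \<and>
    hereditary_free_from_finite_normal_subgroups (lamplighter_group p n)"
proof -
  \<comment> \<open>The hereditary statement comes first, with (Z/pZ)^n as the group
    \<open>A\<close>; the first conjunct is then its special case for the whole group.\<close>
  have "hereditary_free_from_finite_normal_subgroups (lamplighter_group p n)"
    unfolding lamplighter_group_def
    by (intro wreath_integers_hereditary_free product_group group_integer_mod_group)
  then show ?thesis
    using hereditary_free_imp_infinite_normal[OF group_lamplighter_group] by blast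
qed

end
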